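(* For every $\theta>0$ the $\theta$-feasible set satisfies $\mathcal{F}_\theta\subset\mathcal{S}_q$; moreover, $$\lim_{\theta\to0}\mathcal{F}_\theta=\mathcal{S}_q=\left\{(\alpha,\beta,\gamma)\in\mathbb{R}_{++}\times\mathbb{R}_+\times\mathbb{R}_+\;\middle|\;|c_i|\le|1-d_i|\text{ and }0<u_i\text{ for } i=1,\dots,d\right\}.$$
   Context: Let $0<\mu<L$ and let $Q$ be a symmetric $d\times d$ matrix with eigenvalues $0<\mu=\lambda_1(Q)\le\dots\le\lambda_d(Q)=L$. For $\alpha>0$, $\beta,\gamma\ge0$ and $i=1,\dots,d$ let $c_i=(1+\beta)-\alpha(1+\gamma)\lambda_i(Q)$, $d_i=-(\beta-\alpha\gamma\lambda_i(Q))$ and $u_i=\frac{(1+d_i)[(1-d_i)^2-c_i^2]}{\lambda_i(Q)(1-d_i)\alpha^2}$ (a condition on $u_i$ includes that it is defined, i.e. $d_i\ne1$). Let $$A_Q=\begin{bmatrix}(1+\beta)I_d-\alpha(1+\gamma)Q & -(\beta I_d-\alpha\gamma Q)\\ I_d&0_d\end{bmatrix}$$ with spectral radius $\rho(A_Q)$. Define the stable set $\mathcal{S}_q=\{(\alpha,\beta,\gamma)\in\mathbb{R}_{++}\times\mathbb{R}_+\times\mathbb{R}_+\mid\rho(A_Q)<1\}$ and, for $\theta>0$, $$\mathcal{F}_\theta=\left\{(\alpha,\beta,\gamma)\in\mathbb{R}_{++}\times\mathbb{R}_+\times\mathbb{R}_+ \;\middle|\; |c_i|<|1-d_i| \text{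 and } \theta<2u_i\text{ for } i=1,\dots,d\right\}.$$ The sets $\mathcal{F}_\theta$ increase as $\theta$ decreases, and $\lim_{\theta\to0}\mathcal{F}_\theta$ denotes the limit of this monotone family, i.e. $\bigcup_{\theta>0}\mathcal{F}_\theta$. $\mathbb{R}_+$, $\mathbb{R}_{++}$ are the non-negative and the positive reals. *)

theory Defs
  imports "Jordan_Normal_Form.Spectral_Radius"
begin

text \<open>
  The listing of the eigenvalues is one-based, in non-decreasing order and with multiplicity;
  the values of \<open>ev\<close> outside \<open>{1..d}\<close> are irrelevant.
\<close>

definition ordered_eigenvalues :: "real mat \<Rightarrow> nat \<Rightarrow> (nat \<Rightarrow> real) \<Rightarrow> bool" where
  "ordered_eigenvalues Q d ev \<longleftrightarrow>
     char_poly Q = (\<Prod>i=1..d. [:- ev i, 1:]) \<and> mono_on {1..d} ev"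

text \<open>In the next three definitions the argument \<open>l\<close> stands for the eigenvalue \<open>\<lambda>\<^sub>i(Q)\<close>.\<close>

definition c_coef :: "real \<Rightarrow> real \<Rightarrow> real \<Rightarrow> real \<Rightarrow> real" where
  "c_coef \<alpha> \<beta> \<gamma> l = (1 + \<beta>) - \<alpha> * (1 + \<gamma>) * l"

definition d_coef :: "real \<Rightarrow> real \<Rightarrow> real \<Rightarrow> real \<Rightarrow> real" where
  "d_coef \<alpha> \<beta> \<gamma> l = - (\<beta> - \<alpha> * \<gamma> * l)"

text \<open>
  Only meaningful if \<open>d_coef \<alpha> \<beta> \<gamma> l \<noteq> 1\<close>, as division by zero yields zero; this condition is
  stated explicitly wherever \<open>u_coef\<close> is used.
\<close>

definition u_coef :: "real \<Rightarrow> real \<Rightarrow> real \<Rightarrow> real \<Rightarrow> real" where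
  "u_coef \<alpha> \<beta> \<gamma> l =
     (1 + d_coef \<alpha> \<beta> \<gamma> l) * ((1 - d_coef \<alpha> \<beta> \<gamma> l)\<^sup>2 - (c_coef \<alpha> \<beta> \<gamma> l)\<^sup>2)
       / (l * (1 - d_coef \<alpha> \<beta> \<gamma> l) * \<alpha>\<^sup>2)"

definition A_mat :: "nat \<Rightarrow> real mat \<Rightarrow> real \<Rightarrow> real \<Rightarrow> real \<Rightarrow> real mat" where
  "A_mat d Q \<alpha> \<beta> \<gamma> =
     four_block_mat
       ((1 + \<beta>) \<cdot>\<^sub>m 1\<^sub>m d - (\<alpha> * (1 + \<gamma>)) \<cdot>\<^sub>m Q) (- (\<beta> \<cdot>\<^sub>m 1\<^sub>m d - (\<alpha> * \<gamma>) \<cdot>\<^sub>m Q))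
       (1\<^sub>m d)                                   (0\<^sub>m d d)"

definition param_space :: "(real \<times> real \<times> real) set" where
  "param_space = {0<..} \<times> {0..} \<times> {0..}"

definition stable_set :: "nat \<Rightarrow> real mat \<Rightarrow> (real \<times> real \<times> real) set" where
  "stable_set d Q =
     {(\<alpha>, \<beta>, \<gamma>). (\<alpha>, \<beta>, \<gamma>) \<in> param_space \<and>
        spectral_radius (map_mat complex_of_real (A_mat d Q \<alpha> \<beta> \<gamma>)) < 1}"

definition feasible_set :: "nat \<Rightarrow> (nat \<Rightarrow> real) \<Rightarrow> real \<Rightarrow> (real \<times> real \<times> real) set" where
  "feasible_set d ev \<theta> =
     {(\<alpha>, \<beta>, \<gamma>). (\<alpha>, \<beta>, \<gamma>) \<in> param_space \<and>
        (\<forall>i\<in>{1..d}.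
           \<bar>c_coef \<alpha> \<beta> \<gamma> (ev i)\<bar> < \<bar>1 - d_coef \<alpha> \<beta> \<gamma> (ev i)\<bar> \<and>
           d_coef \<alpha> \<beta> \<gamma> (ev i) \<noteq> 1 \<and> \<theta> < 2 * u_coef \<alpha> \<beta> \<gamma> (ev i))}"

end

theory Submission
  imports Defs
begin

text \<open>
  Each eigenvalue \<open>\<lambda>\<^sub>i\<close> of \<open>Q\<close> contributes to \<open>A\<^sub>Q\<close> the two roots of \<open>z\<^sup>2 = c\<^sub>i z + d\<^sub>i\<close>. The
  blocks of \<open>z I - A\<^sub>Q\<close> are affine in \<open>Q\<close>, so its determinant is that of \<open>p I + q Q\<close> for
  scalars \<open>p\<close>, \<open>q\<close> depending on \<open>z\<close>, and this factors over the \<open>\<lambda>\<^sub>i\<close> by the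
  characteristic polynomial of \<open>Q\<close> (\<open>eigenvalue_A_mat_iff\<close>).

  Hence stability says that for every \<open>i\<close> both roots lie in the open unit disc, which for a
  real quadratic is the Schur--Cohn condition \<open>\<bar>c\<^sub>i\<bar> < 1 - d\<^sub>i\<close> and \<open>-1 < d\<^sub>i\<close>
  (\<open>quadratic_roots_norm_less_1_iff\<close>). The sign of \<open>u\<^sub>i\<close> is that of
  \<open>(1 + d\<^sub>i) / (1 - d\<^sub>i)\<close> times \<open>(1 - d\<^sub>i)\<^sup>2 - c\<^sub>i\<^sup>2\<close>. If \<open>\<bar>c\<^sub>i\<bar> \<le> \<bar>1 - d\<^sub>i\<bar>\<close>, the second
  factor is non-negative, so \<open>u\<^sub>i > 0\<close> forces both factors to be positive: the bound on
  \<open>\<bar>c\<^sub>i\<bar>\<close> is strict and \<open>\<bar>d\<^sub>i\<bar> < 1\<close>, which is the Schur--Cohn condition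
  (\<open>weak_bound_u_coef_pos_iff\<close>). This gives the description of the stable set, which visibly
  contains every feasible set. Conversely a stable point is feasible for
  \<open>\<theta> = min\<^sub>i u\<^sub>i\<close>, which is positive because there are finitely many \<open>i\<close>.
\<close>

text \<open>
  For \<open>q \<noteq> 0\<close> this is the characteristic polynomial at \<open>- p / q\<close>, homogenised. The degenerate
  case \<open>q = 0\<close> is included because the coefficient of \<open>Q\<close> in the determinant for \<open>A\<^sub>Q\<close> vanishes
  at \<open>z = \<gamma> / (1 + \<gamma>)\<close>.
\<close>

lemma det_add_scalar_mat:
  fixes M :: "'a :: field mat"
  assumes M: "M \<in> carrier_mat d d"
    and cp: "char_poly M = (\<Prod>i=1..d. [:- e i, 1:])"
  shows "det (p \<cdot>\<^sub>m 1\<^sub>m d + q \<cdot>\<^sub>m M) = (\<Prod>i=1..d. p + q * e i)"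
proof (cases "q = 0")
  case True
  then have "p \<cdot>\<^sub>m 1\<^sub>m d + q \<cdot>\<^sub>m M = p \<cdot>\<^sub>m 1\<^sub>m d"
    using M by (intro eq_matI) auto
  then show ?thesis using True by simp
next
  case False
  have "p \<cdot>\<^sub>m 1\<^sub>m d + q \<cdot>\<^sub>m M = (- q) \<cdot>\<^sub>m (- char_matrix M (- p / q))"
    using M False unfolding char_matrix_def
    by (intro eq_matI) (auto simp: field_simps)
  then have "det (p \<cdot>\<^sub>m 1\<^sub>m d + q \<cdot>\<^sub>m M) = (- q) ^ d * poly (char_poly M) (- p / q)"
    using M by (simp add: char_poly_matrix[OF M] char_matrix_def)
  also have "\<dots> = (\<Prod>i=1..d. - q) * (\<Prod>i=1..d. - e i - p / q)"
    by (simp add: cp poly_prod)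
  also have "\<dots> = (\<Prod>i=1..d. p + q * e i)"
    unfolding prod.distrib[symmetric] using False
    by (intro prod.cong) (auto simp: field_simps)
  finally show ?thesis .
qed

text \<open>
  The lower blocks \<open>I\<close> and \<open>- z I\<close> of \<open>A\<^sub>Q - z I\<close> commute, so its determinant is that of a
  single matrix of size \<open>d\<close>.
\<close>

lemma eigenvalue_A_mat_iff:
  assumes Q: "Q \<in> carrier_mat d d"
    and ev: "char_poly Q = (\<Prod>i=1..d. [:- ev i, 1:])"
  shows "eigenvalue (map_mat complex_of_real (A_mat d Q \<alpha> \<beta> \<gamma>)) z \<longleftrightarrow>
    (\<exists>i\<in>{1..d}. z\<^sup>2 = complex_of_real (c_coef \<alpha> \<beta> \<gamma> (ev i)) * z
                        + complex_of_real (d_coef \<alpha> \<beta> \<gamma> (ev i)))"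
proof -
  let ?M = "map_mat complex_of_real Q"
  let ?A = "map_mat complex_of_real (A_mat d Q \<alpha> \<beta> \<gamma>)"
  let ?C = "complex_of_real (1 + \<beta>) \<cdot>\<^sub>m 1\<^sub>m d - complex_of_real (\<alpha> * (1 + \<gamma>)) \<cdot>\<^sub>m ?M"
  let ?D = "- (complex_of_real \<beta> \<cdot>\<^sub>m 1\<^sub>m d - complex_of_real (\<alpha> * \<gamma>) \<cdot>\<^sub>m ?M)"
  let ?p = "z\<^sup>2 - complex_of_real (1 + \<beta>) * z + complex_of_real \<beta>"
  let ?q = "complex_of_real (\<alpha> * (1 + \<gamma>)) * z - complex_of_real (\<alpha> * \<gamma>)"
  have A: "?A \<in> carrier_mat (d + d) (d + d)"
    using Q by (auto simp: A_mat_def)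
  interpret of_real_poly_hom: map_poly_comm_ring_hom complex_of_real ..
  have M: "?M \<in> carrier_mat d d" using Q by simp
  have "char_poly ?M = map_poly complex_of_real (char_poly Q)"
    by (rule of_real_hom.char_poly_hom[OF Q])
  also have "\<dots> = (\<Prod>i=1..d. [:- complex_of_real (ev i), 1:])"
    unfolding ev by (simp add: of_real_poly_hom.hom_prod of_real_hom.map_poly_pCons_hom)
  finally have cp: "char_poly ?M = (\<Prod>i=1..d. [:- complex_of_real (ev i), 1:])" .
  have "char_matrix ?A z =
      four_block_mat (?C - z \<cdot>\<^sub>m 1\<^sub>m d) ?D (1\<^sub>m d) ((- z) \<cdot>\<^sub>m 1\<^sub>m d)"
    using Q unfolding char_matrix_def A_mat_def
    by (intro eq_matI) auto
  moreover have "det (four_block_mat (?C - z \<cdot>\<^sub>m 1\<^sub>m d) ?D (1\<^sub>m d) ((- z) \<cdot>\<^sub>m 1\<^sub>m d)) =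
      det ((?C - z \<cdot>\<^sub>m 1\<^sub>m d) * ((- z) \<cdot>\<^sub>m 1\<^sub>m d) - ?D * 1\<^sub>m d)"
    using M by (intro det_four_block_mat[of _ d]) auto
  ultimately have "det (char_matrix ?A z) =
      det ((?C - z \<cdot>\<^sub>m 1\<^sub>m d) * ((- z) \<cdot>\<^sub>m 1\<^sub>m d) - ?D * 1\<^sub>m d)"
    by (simp only:)
  also have "(?C - z \<cdot>\<^sub>m 1\<^sub>m d) * ((- z) \<cdot>\<^sub>m 1\<^sub>m d) - ?D * 1\<^sub>m d =
      (- z) \<cdot>\<^sub>m (?C - z \<cdot>\<^sub>m 1\<^sub>m d) - ?D"
  proof -
    have "X * ((- z) \<cdot>\<^sub>m 1\<^sub>m d) - Y * 1\<^sub>m d = (- z) \<cdot>\<^sub>m X - Y"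
      if "X \<in> carrier_mat d d" "Y \<in> carrier_mat d d" for X Y
      by (simp only: mult_smult_distrib[OF that(1) one_carrier_mat]
          right_mult_one_mat[OF that(1)] right_mult_one_mat[OF that(2)])
    then show ?thesis using M by auto
  qed
  also have "\<dots> = ?p \<cdot>\<^sub>m 1\<^sub>m d + ?q \<cdot>\<^sub>m ?M"
    using M by (intro eq_matI) (auto simp: algebra_simps power2_eq_square)
  also have "det \<dots> = (\<Prod>i=1..d. ?p + ?q * complex_of_real (ev i))"
    by (rule det_add_scalar_mat[OF M cp])
  also have "\<dots> = (\<Prod>i=1..d. z\<^sup>2 - (complex_of_real (c_coef \<alpha> \<beta> \<gamma> (ev i)) * z
                        + complex_of_real (d_coef \<alpha> \<beta> \<gamma> (ev i))))"
    by (intro prod.cong) (auto simp: c_coef_def d_coef_def algebra_simps)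
  finally show ?thesis
    unfolding eigenvalue_det[OF A] by auto
qed

lemma spectral_radius_less_iff:
  assumes A: "A \<in> carrier_mat n n" and n: "n > 0"
  shows "spectral_radius A < r \<longleftrightarrow> (\<forall>z. eigenvalue A z \<longrightarrow> cmod z < r)"
  using spectral_radius_mem_max[OF A n] unfolding spectrum_def
  by (force simp: image_iff)

text \<open>
  The Schur--Cohn (Jury) criterion in degree two. The product of the roots is \<open>- d\<close>, whence the
  bound on \<open>d\<close>; and the values \<open>1 - c - d\<close> and \<open>1 + c - d\<close> of \<open>z\<^sup>2 - c z - d\<close> at \<open>1\<close> and
  \<open>-1\<close> must be positive, as otherwise there is a real root at or beyond one of these points.
\<close>

lemma quadratic_roots_norm_less_1_iff:
  fixes c d :: real
  shows "(\<forall>z::complex. z\<^sup>2 = of_real c * z + of_real d \<longrightarrow> cmod z < 1)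
    \<longleftrightarrow> \<bar>c\<bar> < 1 - d \<and> - 1 < d"
proof (intro iffI allI impI)
  assume roots: "\<forall>z::complex. z\<^sup>2 = of_real c * z + of_real d \<longrightarrow> cmod z < 1"
  define s where "s = csqrt (of_real (c\<^sup>2 + 4 * d))"
  have s2: "s\<^sup>2 = of_real c ^ 2 + 4 * of_real d"
    unfolding s_def by simp
  have "cmod ((of_real c + s) / 2) < 1" "cmod ((of_real c - s) / 2) < 1"
    using s2 by (intro roots[rule_format]; simp add: field_simps power2_eq_square)+
  then have "cmod ((of_real c + s) / 2 * ((of_real c - s) / 2)) < 1 * 1"
    unfolding norm_mult by (intro mult_strict_mono') auto
  also have "(of_real c + s) / 2 * ((of_real c - s) / 2) = - complex_of_real d"
    using s2 by (simp add: field_simps power2_eq_square)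
  finally have d: "\<bar>d\<bar> < 1" by simp
  have "\<bar>c\<bar> < 1 - d"
  proof (rule ccontr)
    assume "\<not> \<bar>c\<bar> < 1 - d"
    then have c: "1 - d \<le> \<bar>c\<bar>" by simp
    then have "(1 - d)\<^sup>2 \<le> c\<^sup>2"
      using d by (metis abs_le_square_iff abs_of_pos diff_gt_0_iff_gt abs_less_iff)
    then have disc: "(1 + d)\<^sup>2 \<le> c\<^sup>2 + 4 * d"
      by (simp add: power2_eq_square algebra_simps)
    \<comment> \<open>The discriminant is non-negative, so the root \<open>x\<close> of larger modulus is real.\<close>
    define t where "t = sqrt (c\<^sup>2 + 4 * d)"
    define x where "x = (c + (if c < 0 then - t else t)) / 2"
    have t: "1 + d \<le> t" unfolding t_def using disc d by (intro real_le_rsqrt) auto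
    have "t\<^sup>2 = c\<^sup>2 + 4 * d" unfolding t_def
      using disc by (intro real_sqrt_pow2) (smt (verit) zero_le_power2)
    then have "x\<^sup>2 = c * x + d"
      unfolding x_def by (auto simp: field_simps power2_eq_square)
    then have "(complex_of_real x)\<^sup>2 = of_real c * of_real x + of_real d"
      by (metis of_real_add of_real_mult of_real_power)
    with roots have "\<bar>x\<bar> < 1" by (metis norm_of_real)
    with t c show False unfolding x_def by (auto split: if_splits)
  qed
  with d show "\<bar>c\<bar> < 1 - d \<and> - 1 < d" by simp
next
  fix z :: complex
  assume cd: "\<bar>c\<bar> < 1 - d \<and> - 1 < d" and z: "z\<^sup>2 = of_real c * z + of_real d"
  define x y where "x = Re z" and "y = Im z"
  have re: "x\<^sup>2 - y\<^sup>2 = c * x + d" and im: "2 * x * y = c * y"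
    using arg_cong[OF z, of Re] arg_cong[OF z, of Im]
    by (simp_all add: x_def y_def power2_eq_square)
  have "x\<^sup>2 + y\<^sup>2 < 1"
  proof (cases "y = 0")
    \<comment> \<open>The roots are conjugate, so \<open>- d\<close> is the squared modulus of either.\<close>
    case False
    then have "c = 2 * x" using im by simp
    with re have "x\<^sup>2 + y\<^sup>2 = - d" by (simp add: power2_eq_square)
    with cd show ?thesis by simp
  next
    case True
    have "\<bar>x\<bar> < 1"
    proof (rule ccontr)
      assume "\<not> \<bar>x\<bar> < 1"
      then have x: "1 \<le> \<bar>x\<bar>" by simp
      \<comment> \<open>The polynomial \<open>t\<^sup>2 - \<bar>c\<bar> t\<close> at \<open>t = \<bar>x\<bar>\<close> minus its value at \<open>1\<close>, factored.\<close>
      have "0 \<le> (\<bar>x\<bar> - 1) * (\<bar>x\<bar> + 1 - \<bar>c\<bar>)"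
        using x cd by (intro mult_nonneg_nonneg) auto
      also have "\<dots> = x\<^sup>2 - \<bar>c\<bar> * \<bar>x\<bar> - (1 - \<bar>c\<bar>)"
        by (simp add: algebra_simps power2_eq_square)
      also have "\<dots> \<le> x\<^sup>2 - c * x - (1 - \<bar>c\<bar>)"
        using abs_ge_self[of "c * x"] by (simp add: abs_mult)
      also have "\<dots> < 0"
        using re True cd by simp
      finally show False by simp
    qed
    then show ?thesis using True by (simp add: abs_square_less_1)
  qed
  then show "cmod z < 1"
    by (simp add: cmod_def x_def y_def)
qed

text \<open>
  The right-hand side is the Schur--Cohn condition. Since it makes the inequality for \<open>\<bar>c\<bar>\<close>
  strict, the lemma also shows that a feasible set and the description of the stable set differ
  only in the lower bound on \<open>u\<close>.
\<close>

lemma weak_bound_u_coef_pos_iff: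
  fixes \<alpha> \<beta> \<gamma> l :: real
  defines "c \<equiv> c_coef \<alpha> \<beta> \<gamma> l" and "d \<equiv> d_coef \<alpha> \<beta> \<gamma> l"
  assumes "0 < \<alpha>" "0 < l"
  shows "\<bar>c\<bar> \<le> \<bar>1 - d\<bar> \<and> d \<noteq> 1 \<and> 0 < u_coef \<alpha> \<beta> \<gamma> l \<longleftrightarrow> \<bar>c\<bar> < 1 - d \<and> - 1 < d"
proof -
  have u: "u_coef \<alpha> \<beta> \<gamma> l = ((1 + d) / (1 - d)) * ((1 - d)\<^sup>2 - c\<^sup>2) / (l * \<alpha>\<^sup>2)"
    unfolding u_coef_def c_def d_def by (simp add: mult.commute mult.left_commute)
  have "0 < u_coef \<alpha> \<beta> \<gamma> l \<longleftrightarrow> 0 < ((1 + d) / (1 - d)) * ((1 - d)\<^sup>2 - c\<^sup>2)"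
    unfolding u using assms(3,4) by (intro pos_less_divide_eq[of "l * \<alpha>\<^sup>2" 0, simplified]) simp
  moreover have "0 \<le> (1 - d)\<^sup>2 - c\<^sup>2 \<longleftrightarrow> \<bar>c\<bar> \<le> \<bar>1 - d\<bar>"
    and "0 < (1 - d)\<^sup>2 - c\<^sup>2 \<longleftrightarrow> \<bar>c\<bar> < \<bar>1 - d\<bar>"
    using abs_le_square_iff[of c "1 - d"] abs_le_square_iff[of "1 - d" c] by auto
  moreover have "0 < (1 + d) / (1 - d) \<longleftrightarrow> \<bar>d\<bar> < 1"
    by (auto simp: zero_less_divide_iff)
  ultimately show ?thesis
    unfolding zero_less_mult_iff by (smt (verit))
qed

lemma stable_set_eq:
  assumes d: "1 \<le> d" and Q: "Q \<in> carrier_mat d d"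
    and ev: "char_poly Q = (\<Prod>i=1..d. [:- ev i, 1:])"
    and pos: "\<forall>i\<in>{1..d}. 0 < ev i"
  shows "stable_set d Q =
        {(\<alpha>, \<beta>, \<gamma>). (\<alpha>, \<beta>, \<gamma>) \<in> param_space \<and>
           (\<forall>i\<in>{1..d}.
              \<bar>c_coef \<alpha> \<beta> \<gamma> (ev i)\<bar> \<le> \<bar>1 - d_coef \<alpha> \<beta> \<gamma> (ev i)\<bar> \<and>
              d_coef \<alpha> \<beta> \<gamma> (ev i) \<noteq> 1 \<and> 0 < u_coef \<alpha> \<beta> \<gamma> (ev i))}"
proof -
  have "spectral_radius (map_mat complex_of_real (A_mat d Q \<alpha> \<beta> \<gamma>)) < 1 \<longleftrightarrow>
      (\<forall>i\<in>{1..d}.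
              \<bar>c_coef \<alpha> \<beta> \<gamma> (ev i)\<bar> \<le> \<bar>1 - d_coef \<alpha> \<beta> \<gamma> (ev i)\<bar> \<and>
              d_coef \<alpha> \<beta> \<gamma> (ev i) \<noteq> 1 \<and> 0 < u_coef \<alpha> \<beta> \<gamma> (ev i))"
    if "0 < \<alpha>" for \<alpha> \<beta> \<gamma>
  proof -
    let ?A = "map_mat complex_of_real (A_mat d Q \<alpha> \<beta> \<gamma>)"
    have "?A \<in> carrier_mat (d + d) (d + d)"
      using Q by (auto simp: A_mat_def)
    then have "spectral_radius ?A < 1 \<longleftrightarrow> (\<forall>z. eigenvalue ?A z \<longrightarrow> cmod z < 1)"
      using d by (intro spectral_radius_less_iff) auto
    also have "\<dots> \<longleftrightarrow> (\<forall>i\<in>{1..d}. \<forall>z. z\<^sup>2 = complex_of_real (c_coef \<alpha> \<beta> \<gamma> (ev i)) * z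
                        + complex_of_real (d_coef \<alpha> \<beta> \<gamma> (ev i)) \<longrightarrow> cmod z < 1)"
      unfolding eigenvalue_A_mat_iff[OF Q ev] by blast
    finally show ?thesis
      by (simp add: quadratic_roots_norm_less_1_iff weak_bound_u_coef_pos_iff[OF that] pos)
  qed
  then show ?thesis
    by (auto simp: stable_set_def param_space_def)
qed

theorem lemmaE1:
  fixes \<mu> L :: real and d :: nat and Q :: "real mat" and ev :: "nat \<Rightarrow> real"
  assumes "0 < \<mu>" and "\<mu> < L"
    and "1 \<le> d"
    and "Q \<in> carrier_mat d d" and "transpose_mat Q = Q"
    and "ordered_eigenvalues Q d ev"
    and "ev 1 = \<mu>" and "ev d = L"
  shows "(\<forall>\<theta>>0. feasible_set d ev \<theta> \<subseteq> stable_set d Q)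
    \<and> (\<Union>\<theta>\<in>{0<..}. feasible_set d ev \<theta>) = stable_set d Q
    \<and> stable_set d Q =
        {(\<alpha>, \<beta>, \<gamma>). (\<alpha>, \<beta>, \<gamma>) \<in> param_space \<and>
           (\<forall>i\<in>{1..d}.
              \<bar>c_coef \<alpha> \<beta> \<gamma> (ev i)\<bar> \<le> \<bar>1 - d_coef \<alpha> \<beta> \<gamma> (ev i)\<bar> \<and>
              d_coef \<alpha> \<beta> \<gamma> (ev i) \<noteq> 1 \<and> 0 < u_coef \<alpha> \<beta> \<gamma> (ev i))}"
proof -
  have cp: "char_poly Q = (\<Prod>i=1..d. [:- ev i, 1:])" and mono: "mono_on {1..d} ev"
    using assms unfolding ordered_eigenvalues_def by auto
  have pos: "\<forall>i\<in>{1..d}. 0 < ev i"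
    using mono_onD[OF mono, of 1] assms by fastforce
  note S = stable_set_eq[OF assms(3,4) cp pos]
  have sub: "feasible_set d ev \<theta> \<subseteq> stable_set d Q" if "0 < \<theta>" for \<theta>
    unfolding S feasible_set_def using that by fastforce
  have "p \<in> (\<Union>\<theta>\<in>{0<..}. feasible_set d ev \<theta>)" if p: "p \<in> stable_set d Q" for p
  proof -
    obtain \<alpha> \<beta> \<gamma> where p_eq: "p = (\<alpha>, \<beta>, \<gamma>)" by (cases p) auto
    have par: "(\<alpha>, \<beta>, \<gamma>) \<in> param_space" and
      bounds: "\<And>i. i \<in> {1..d} \<Longrightarrow> \<bar>c_coef \<alpha> \<beta> \<gamma> (ev i)\<bar> \<le> \<bar>1 - d_coef \<alpha> \<beta> \<gamma> (ev i)\<bar> \<and>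
              d_coef \<alpha> \<beta> \<gamma> (ev i) \<noteq> 1 \<and> 0 < u_coef \<alpha> \<beta> \<gamma> (ev i)"
      using p unfolding S p_eq by auto
    have "0 < \<alpha>" using par by (simp add: param_space_def)
    then have strict: "\<bar>c_coef \<alpha> \<beta> \<gamma> (ev i)\<bar> < \<bar>1 - d_coef \<alpha> \<beta> \<gamma> (ev i)\<bar>"
      if "i \<in> {1..d}" for i
      using bounds[OF that] weak_bound_u_coef_pos_iff[OF _ pos[rule_format, OF that], of \<alpha> \<beta> \<gamma>] by linarith
    define \<theta> where "\<theta> = Min ((\<lambda>i. u_coef \<alpha> \<beta> \<gamma> (ev i)) ` {1..d})"
    have "0 < \<theta>" unfolding \<theta>_def using assms(3) bounds by (subst Min_gr_iff) auto
    moreover have "\<theta> < 2 * u_coef \<alpha> \<beta> \<gamma> (ev i)" if "i \<in> {1..d}" for i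
    proof -
      have "\<theta> \<le> u_coef \<alpha> \<beta> \<gamma> (ev i)" unfolding \<theta>_def using that by (intro Min_le) auto
      with bounds[OF that] show ?thesis by simp
    qed
    ultimately have "p \<in> feasible_set d ev \<theta>"
      using par bounds strict unfolding p_eq feasible_set_def by auto
    with \<open>0 < \<theta>\<close> show ?thesis by auto
  qed
  with sub S show ?thesis by fast
qed

end
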